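(* Let $n \ge 2$ be an integer. Then $\mathcal{M}_n(\mathbb{Q})$ is dense in $\mathbb{R}^n$.
   Context: A vector $\mathbf{v}=(v_1,\dots,v_n)\in\mathbb{R}^n$ is multiplicatively dependent if all its coordinates are non-zero and there is a non-zero integer vector $(k_1,\dots,k_n)\in\mathbb{Z}^n$ with $v_1^{k_1}\cdots v_n^{k_n}=1$. For $S\subseteq\mathbb{R}$, $\mathcal{M}_n(S)$ denotes the set of multiplicatively dependent vectors in $\mathbb{R}^n$ all of whose coordinates lie in $S$. *)

theory Defs
  imports "HOL-Analysis.Analysis"
begin

definition mult_dependent :: "real ^ 'n \<Rightarrow> bool" where
  "mult_dependent v \<longleftrightarrow>
     (\<forall>i. v $ i \<noteq> 0) \<and> (\<exists>k :: int ^ 'n. k \<noteq> 0 \<and> (\<Prod>i\<in>UNIV. (v $ i) powi (k $ i)) = 1)"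

definition mult_dependent_vectors :: "real set \<Rightarrow> (real ^ 'n) set" where
  "mult_dependent_vectors S = {v. mult_dependent v \<and> (\<forall>i. v $ i \<in> S)}"

end

theory Submission imports Defs begin

text \<open>For a rational \<open>r > 1\<close> close to \<open>1\<close>, the numbers \<open>\<plusminus>r\<^sup>m\<close> with \<open>m\<close> an integer form a fine mesh
  away from \<open>0\<close>, and any two of them are multiplicatively dependent. So every vector can be approximated
  by one all of whose coordinates are of this form, with the same \<open>r\<close>.\<close>

lemma power_int_approx:
  fixes r y :: real
  assumes "1 < r" "0 < y"
  obtains m where "r powi m \<le> y" "y < r powi m * r"
proof
  define m where "m = \<lfloor>log r y\<rfloor>"
  have powi: "r powi n = r powr real_of_int n" for n
    using assms by (simp add: powr_real_of_int')
  show "r powi m \<le> y"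
    unfolding powi using assms by (simp add: m_def powr_le_iff le_log_iff [symmetric])
  have "y < r powr (real_of_int m + 1)"
    using assms by (simp add: m_def log_less_iff [symmetric])
  then show "y < r powi m * r"
    unfolding powi using assms by (simp add: powr_add)
qed

text \<open>Positive powers of \<open>r\<close> never reach 0, so \<open>\<bar>x\<bar>\<close> is
  first shifted to \<open>\<bar>x\<bar> + e\<close>, which covers \<open>x = 0\<close> too. The
  bound adds the mesh width near the shifted point and the cost \<open>e\<close> of the
  shift.\<close>

lemma signed_power_int_approx:
  fixes r x e :: real
  assumes "1 < r" "0 < e"
  obtains s m where "\<bar>s\<bar> = 1" "s \<in> \<rat>" "\<bar>s * r powi m - x\<bar> \<le> (r - 1) * (\<bar>x\<bar> + e) + e"
proof -
  have "0 < \<bar>x\<bar> + e" using assms by linarith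
  then obtain m where m: "r powi m \<le> \<bar>x\<bar> + e" "\<bar>x\<bar> + e < r powi m * r"
    using power_int_approx assms(1) by blast
  \<comment> \<open>The left side is the gap between the consecutive powers that enclose
    \<open>\<bar>x\<bar> + e\<close>.\<close>
  have "(r - 1) * r powi m \<le> (r - 1) * (\<bar>x\<bar> + e)"
    using m(1) assms(1) by (intro mult_left_mono) auto
  with m(2) have "\<bar>x\<bar> + e - r powi m \<le> (r - 1) * (\<bar>x\<bar> + e)"
    by (simp add: algebra_simps)
  then have le: "\<bar>r powi m - \<bar>x\<bar>\<bar> \<le> (r - 1) * (\<bar>x\<bar> + e) + e"
    using m(1) assms by (simp add: abs_le_iff)
  \<comment> \<open>Since \<open>x = s * \<bar>x\<bar>\<close>, multiplying by \<open>s\<close>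
    carries the estimate for \<open>\<bar>x\<bar>\<close> over to \<open>x\<close>.\<close>
  define s :: real where "s = (if x \<ge> 0 then 1 else -1)"
  have "\<bar>s\<bar> = 1" "s \<in> \<rat>" by (auto simp: s_def)
  moreover have "\<bar>s * r powi m - x\<bar> \<le> (r - 1) * (\<bar>x\<bar> + e) + e"
    using le by (auto simp: s_def abs_if split: if_splits)
  ultimately show thesis using that by blast
qed

lemma signed_power_int_even:
  fixes s r :: real
  assumes "\<bar>s\<bar> = 1"
  shows "(s * r powi m) powi (2 * a) = r powi (m * (2 * a))"
proof -
  have "s\<^sup>2 = 1" using assms by (simp add: power2_eq_1_iff abs_if split: if_splits)
  then show ?thesis by (simp add: power_int_mult power_mult_distrib)
qed

text \<open>Two coordinates suffice: raising the \<open>i\<close>-th to \<open>m j\<close> and the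
  \<open>j\<close>-th to \<open>- m i\<close> makes the powers of \<open>r\<close> cancel. Doubling
  both exponents removes the signs.\<close>

lemma mult_dependent_signed_powers:
  fixes v :: "real ^ 'n::finite"
  assumes card: "CARD('n) \<ge> 2" and r: "r \<noteq> 0"
    and s: "\<And>i. \<bar>s i\<bar> = 1" and v: "\<And>i. v $ i = s i * r powi m i"
  shows "mult_dependent v"
proof -
  obtain i j :: 'n where ij: "i \<noteq> j"
    using card card_le_Suc0_iff_eq [of "UNIV :: 'n set"] by force
  have even_pow: "v $ l powi (2 * a) = r powi (m l * (2 * a))" for l a
    unfolding v by (rule signed_power_int_even [OF s])
  have "\<exists>k :: int ^ 'n. k \<noteq> 0 \<and> (\<Prod>l\<in>UNIV. v $ l powi (k $ l)) = 1"
  \<comment> \<open>If \<open>m i = 0\<close>, the cancelling exponents could both vanish, but then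
    coordinate \<open>i\<close> is 1 or -1 and its square alone gives a relation.\<close>
  proof (cases "m i = 0")
    case True
    define k :: "int ^ 'n" where "k = axis i 2"
    have "v $ l powi (k $ l) = 1" for l
      using even_pow [of i 1] True by (simp add: k_def axis_def)
    moreover have "k \<noteq> 0" by (simp add: k_def axis_eq_0_iff)
    ultimately show ?thesis by (intro exI [of _ k]) simp
  next
    case False
    define k :: "int ^ 'n"
      where "k = (\<chi> l. if l = i then 2 * m j else if l = j then 2 * (- m i) else 0)"
    have "k $ j \<noteq> 0" using ij False by (simp add: k_def)
    then have "k \<noteq> 0" by auto
    moreover have "(\<Prod>l\<in>UNIV. v $ l powi (k $ l)) = (\<Prod>l\<in>{i, j}. v $ l powi (k $ l))"
      by (rule prod.mono_neutral_right) (auto simp: k_def)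
    \<comment> \<open>The exponent must keep the shape \<open>2 * a\<close> with
      \<open>a = - m i\<close> for \<open>even_pow\<close> to match, so the minus sign is not pulled
      out.\<close>
    moreover have "\<dots> = r powi (m i * (2 * m j)) * r powi (m j * (2 * (- m i)))"
      using ij by (simp add: k_def even_pow del: mult_minus_right)
    moreover have "\<dots> = 1"
      using r by (simp flip: power_int_add add: algebra_simps)
    ultimately show ?thesis by (intro exI [of _ k]) simp
  qed
  moreover have "v $ l \<noteq> 0" for l
    using r s [of l] by (auto simp: v)
  ultimately show ?thesis by (simp add: mult_dependent_def)
qed

theorem corollary1p2:
  assumes "CARD('n::finite) \<ge> 2"
  shows "closure (mult_dependent_vectors \<rat> :: (real ^ 'n) set) = UNIV"
proof -
  have "\<exists>v\<in>mult_dependent_vectors \<rat>. dist v x < d" if "d > 0" for x :: "real ^ 'n" and d :: real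
  proof -
    \<comment> \<open>Each coordinate will be off by at most \<open>2 * e\<close>, so the l1
      distance is at most \<open>2 * d / 3\<close>.\<close>
    define e where "e = d / (3 * CARD('n))"
    have e: "e > 0" using that by (simp add: e_def)
    then have B: "norm x + e > 0" by (simp add: add_nonneg_pos)
    \<comment> \<open>The bound makes \<open>(r - 1) * (norm x + e) < e\<close>. As
      \<open>norm x\<close> dominates every \<open>\<bar>x $ i\<bar>\<close>, one \<open>r\<close>
      serves all coordinates.\<close>
    then obtain r where r: "r \<in> \<rat>" "1 < r" "r < 1 + e / (norm x + e)"
      using Rats_dense_in_real [of 1 "1 + e / (norm x + e)"] e by auto
    have "\<forall>i. \<exists>s m. \<bar>s\<bar> = 1 \<and> s \<in> \<rat> \<and> \<bar>s * r powi m - x $ i\<bar> \<le> (r - 1) * (\<bar>x $ i\<bar> + e) + e"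
      using signed_power_int_approx [OF r(2) e] by metis
    then obtain s m where sm: "\<And>i. \<bar>s i\<bar> = 1" "\<And>i. s i \<in> \<rat>"
      "\<And>i. \<bar>s i * r powi m i - x $ i\<bar> \<le> (r - 1) * (\<bar>x $ i\<bar> + e) + e"
      by metis
    define v :: "real ^ 'n" where "v = (\<chi> i. s i * r powi m i)"
    have "mult_dependent v"
      by (rule mult_dependent_signed_powers [of r s _ m]) (use assms r sm in \<open>auto simp: v_def\<close>)
    moreover have "v $ i \<in> \<rat>" for i
      using r(1) sm(2) by (simp add: v_def power_int_def)
    ultimately have "v \<in> mult_dependent_vectors \<rat>"
      by (simp add: mult_dependent_vectors_def)
    moreover have "dist v x < d"
    proof -
      have "\<bar>(v - x) $ i\<bar> \<le> 2 * e" for i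
      proof -
        have "(r - 1) * (\<bar>x $ i\<bar> + e) \<le> (r - 1) * (norm x + e)"
          using r(2) component_le_norm_cart [of x i] by (intro mult_left_mono) auto
        also have "\<dots> \<le> e"
          using r(3) B pos_less_divide_eq [of "norm x + e" "r - 1" e] by linarith
        finally show ?thesis using sm(3) [of i] by (simp add: v_def)
      qed
      then have "(\<Sum>i\<in>UNIV. \<bar>(v - x) $ i\<bar>) \<le> CARD('n) * (2 * e)"
        by (intro sum_bounded_above) auto
      also have "\<dots> < d" using that by (simp add: e_def)
      finally show ?thesis
        using norm_le_l1_cart [of "v - x"] by (simp add: dist_norm)
    qed
    ultimately show ?thesis by blast
  qed
  then show ?thesis by (auto simp: closure_approachable)
qed

end
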